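(* Let $E$ be a nonzero real Banach space, let $f : E \times E^* \to\, ]-\infty,\infty]$ be proper, convex and lower semicontinuous, and suppose $f \ge q_L$ on $E \times E^*$. For all $c, b \in E \times E^*$, let $$f_c(b) := f(b + c) - \langle b, Lc\rangle - q_L(c) = (f - q_L)(b + c) + q_L(b) \ \ge\ q_L(b).$$ Then the following are equivalent: (a) $\{b \in E \times E^* : f(b) = q_L(b)\}$ is quasidense in $E \times E^*$. (b) For all $c \in E \times E^*$, $\inf_{b \in E \times E^*}\big[f_c(b) + \tfrac12\|b\|^2\big] \le 0$.
   Context: $E \times E^*$ is normed by $\|(x,x^* )\| := \sqrt{\|x\|^2 + \|x^*\|^2}$, and its dual is $E^* \times E^{**}$ under the pairing $\langle (x,x^* ), (y^*,y^{**})\rangle := \langle x, y^*\rangle + \langle x^*, y^{**}\rangle$. $\widehat{x}$ is the canonical image of $x \in E$ in $E^{**}$. $L : E \times E^* \to E^* \times E^{**}$ is the linear map $L(x,x^* ) := (x^*, \widehat{x})$, and $q_L(x,x^* ) := \langle x, x^*\rangle$. A subset $A \subset E \times E^*$ is quasidense (in $E \times E^*$) if, for all $(x,x^* ) \in E \times E^*$, $\inf_{(s,s^* ) \in A}\big[\frac12\|s-x\|^2 + \frac12\|s^*-x^*\|^2 + \langle s-x, s^*-x^*\rangle\big] \le 0$. A function is proper if it is finite somewhere. *)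

theory Defs
  imports "HOL-Analysis.Analysis"
begin

type_synonym 'a dual = "'a \<Rightarrow>\<^sub>L real"

lift_definition canonical_bidual :: "'a::real_normed_vector \<Rightarrow> 'a dual dual"
  is "\<lambda>x y. blinfun_apply y x"
  by (rule blinfun.bounded_linear_left)

text \<open>The norm of \<open>E \<times> E\<^sup>*\<close> is the library norm of product types, which is
  the Euclidean combination of the two norms (see \<open>norm_prod_def\<close>).\<close>

text \<open>The pairing of \<open>E \<times> E\<^sup>*\<close> with its dual \<open>E\<^sup>* \<times> E\<^sup>*\<^sup>*\<close>.\<close>

fun prod_pairing ::
  "'a::real_normed_vector \<times> 'a dual \<Rightarrow> 'a dual \<times> 'a dual dual \<Rightarrow> real"
  where "prod_pairing (x, x') (y', y'') = blinfun_apply y' x + blinfun_apply y'' x'"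

fun L_map :: "'a::real_normed_vector \<times> 'a dual \<Rightarrow> 'a dual \<times> 'a dual dual"
  where "L_map (x, x') = (x', canonical_bidual x)"

fun q_L :: "'a::real_normed_vector \<times> 'a dual \<Rightarrow> real"
  where "q_L (x, x') = blinfun_apply x' x"

text \<open>The infimum is taken in \<^typ>\<open>ereal\<close>, so that it is \<open>\<infinity>\<close> over the empty set:
  the empty set is not quasidense.\<close>

definition quasidense :: "('a::real_normed_vector \<times> 'a dual) set \<Rightarrow> bool"
  where "quasidense A \<longleftrightarrow>
    (\<forall>x x'. (INF (s, s')\<in>A.
       ereal (1/2 * (norm (s - x))\<^sup>2 + 1/2 * (norm (s' - x'))\<^sup>2
              + blinfun_apply (s' - x') (s - x))) \<le> 0)"

definition proper_fun :: "('b \<Rightarrow> ereal) \<Rightarrow> bool"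
  where "proper_fun f \<longleftrightarrow> (\<exists>b. \<bar>f b\<bar> \<noteq> \<infinity>)"

definition convex_fun :: "('b::real_vector \<Rightarrow> ereal) \<Rightarrow> bool"
  where "convex_fun f \<longleftrightarrow>
    (\<forall>a b t. 0 < t \<and> t < 1 \<longrightarrow>
       f ((1 - t) *\<^sub>R a + t *\<^sub>R b) \<le> ereal (1 - t) * f a + ereal t * f b)"

definition lower_semicontinuous :: "('b::topological_space \<Rightarrow> ereal) \<Rightarrow> bool"
  where "lower_semicontinuous f \<longleftrightarrow>
    (\<forall>b r. r < f b \<longrightarrow> eventually (\<lambda>y. r < f y) (nhds b))"

text \<open>\<open>shifted f c\<close> is the function $f_c$.\<close>

definition shifted ::
  "('a::real_normed_vector \<times> 'a dual \<Rightarrow> ereal) \<Rightarrow> 'a \<times> 'a dual \<Rightarrow> 'a \<times> 'a dual \<Rightarrow> ereal"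
  where "shifted f c b = f (b + c) - ereal (prod_pairing b (L_map c)) - ereal (q_L c)"

end

theory Submission
  imports Defs
begin

text \<open>
  Write \<open>r_L b = \<parallel>b\<parallel>\<^sup>2 / 2 + q_L b\<close>. Since \<open>\<bar>q_L\<bar> \<le> \<parallel>\<cdot>\<parallel>\<^sup>2 / 2\<close>, both summands of
  \<open>f\<^sub>c(b) + \<parallel>b\<parallel>\<^sup>2 / 2 = (f - q_L)(b + c) + r_L b\<close> are nonnegative. Hence condition (b) says that
  for every \<open>c\<close> and \<open>\<epsilon> > 0\<close> there is a point \<open>s\<close> with \<open>(f - q_L)(s) \<le> \<epsilon>\<close> and \<open>r_L (s - c) \<le> \<epsilon>\<close>
  (\<open>shifted_infimum_iff_approx\<close>), whereas quasidensity of the coincidence set asks for such a point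
  with \<open>(f - q_L)(s) = 0\<close>. So (a) implies (b) at once, and the converse has to turn approximate
  coincidence points into exact ones.

  The tool is convexity. As \<open>f\<close> is convex and \<open>f \<ge> q_L\<close>, comparing \<open>f\<close> and \<open>q_L\<close> at the midpoint
  of two points where \<open>f - q_L\<close> is small shows that \<open>q_L\<close> of their difference cannot be very
  negative (\<open>neg_q_L_diff_le\<close>). If moreover \<open>r_L\<close> of the difference is small, then the two points
  are close in norm. Starting from an approximate coincidence point \<open>s\<^sub>0\<close>, repeated use of the
  approximation property, each time with \<open>c\<close> the latest point and a smaller \<open>\<epsilon>\<close>, therefore gives a
  Cauchy sequence; by completeness and lower semicontinuity its limit is a coincidence point, at a
  small distance from \<open>s\<^sub>0\<close> (\<open>coincidence_point_near\<close>).

  It remains to see that \<open>r_L (s - c)\<close> is small when \<open>r_L (s\<^sub>0 - c)\<close> and \<open>\<parallel>s - s\<^sub>0\<parallel>\<close> are. As \<open>r_L\<close> is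
  quadratic, this needs a bound on \<open>\<parallel>s\<^sub>0 - c\<parallel>\<close> that does not depend on the accuracy of \<open>s\<^sub>0\<close>; the
  same convexity estimate, applied to \<open>s\<^sub>0\<close> and a fixed point of the domain of \<open>f\<close>, provides it
  (\<open>approx_coincidence_bounded\<close>).
\<close>

section \<open>The quadratic forms on the product space\<close>

definition r_L :: "'a::real_normed_vector \<times> 'a dual \<Rightarrow> real"
  where "r_L b = 1/2 * (norm b)\<^sup>2 + q_L b"

lemma q_L_eq: "q_L b = blinfun_apply (snd b) (fst b)"
  by (cases b) simp

lemma pairing_L_eq:
  "prod_pairing b (L_map c) = blinfun_apply (snd c) (fst b) + blinfun_apply (snd b) (fst c)"
  by (cases b; cases c) (simp add: canonical_bidual.rep_eq)

lemma q_L_add: "q_L (b + c) = q_L b + prod_pairing b (L_map c) + q_L c"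
  by (simp add: q_L_eq pairing_L_eq blinfun.add_left blinfun.add_right)

lemma norm_prod_square: "(norm b)\<^sup>2 = (norm (fst b))\<^sup>2 + (norm (snd b))\<^sup>2"
  by (simp add: norm_prod_def)

lemma abs_pairing_L_le: "\<bar>prod_pairing b (L_map c)\<bar> \<le> norm b * norm c"
proof -
  let ?x = "norm (fst b)" and ?x' = "norm (snd b)" and ?y = "norm (fst c)" and ?y' = "norm (snd c)"
  have "\<bar>blinfun_apply (snd c) (fst b)\<bar> \<le> ?y' * ?x" "\<bar>blinfun_apply (snd b) (fst c)\<bar> \<le> ?x' * ?y"
    using norm_blinfun[of "snd c" "fst b"] norm_blinfun[of "snd b" "fst c"] by auto
  then have "\<bar>prod_pairing b (L_map c)\<bar> \<le> ?y' * ?x + ?x' * ?y"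
    unfolding pairing_L_eq by linarith
  also have "\<dots> \<le> norm b * norm c"
  proof (rule power2_le_imp_le)
    have "(norm b * norm c)\<^sup>2 - (?y' * ?x + ?x' * ?y)\<^sup>2 = (?x * ?y - ?x' * ?y')\<^sup>2"
      by (simp add: power_mult_distrib norm_prod_square) (simp add: power2_eq_square algebra_simps)
    then show "(?y' * ?x + ?x' * ?y)\<^sup>2 \<le> (norm b * norm c)\<^sup>2"
      using zero_le_power2[of "?x * ?y - ?x' * ?y'"] by linarith
  qed simp
  finally show ?thesis .
qed

lemma abs_q_L_le: "\<bar>q_L b\<bar> \<le> 1/2 * (norm b)\<^sup>2"
proof -
  have "prod_pairing b (L_map b) = 2 * q_L b"
    by (simp add: pairing_L_eq q_L_eq)
  then show ?thesis
    using abs_pairing_L_le[of b b] by (simp add: power2_eq_square)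
qed

lemma r_L_nonneg: "0 \<le> r_L b"
  using abs_q_L_le[of b] by (auto simp: r_L_def abs_le_iff)

lemma r_L_add_le: "r_L (v + d) \<le> r_L v + 2 * norm v * norm d + (norm d)\<^sup>2"
proof -
  have "(norm (v + d))\<^sup>2 \<le> (norm v + norm d)\<^sup>2"
    by (rule power_mono) (auto simp: norm_triangle_ineq)
  moreover have "q_L (v + d) \<le> q_L v + norm v * norm d + 1/2 * (norm d)\<^sup>2"
    unfolding q_L_add using abs_pairing_L_le[of v d] abs_q_L_le[of d] by linarith
  ultimately show ?thesis
    by (simp add: r_L_def power2_sum algebra_simps)
qed

lemma tendsto_q_L:
  assumes "(s \<longlongrightarrow> l) F"
  shows "((\<lambda>n. q_L (s n)) \<longlongrightarrow> q_L l) F"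
  unfolding q_L_eq by (intro tendsto_intros assms)

section \<open>Consequences of convexity and lower semicontinuity\<close>

text \<open>
  Compare \<open>f\<close> and \<open>q_L\<close> at the midpoint, where
  \<open>q_L ((a + b) / 2) = q_L a / 2 + q_L b / 2 - q_L (a - b) / 4\<close>: the last term must be absorbed by
  the excesses of \<open>f\<close> over \<open>q_L\<close> at the two ends.
\<close>

lemma neg_q_L_diff_le:
  assumes "convex_fun f" "\<And>b. ereal (q_L b) \<le> f b"
    and "f a \<le> ereal (q_L a + \<alpha>)" "f b \<le> ereal (q_L b + \<beta>)"
  shows "- q_L (a - b) \<le> 2 * \<alpha> + 2 * \<beta>"
proof -
  define m where "m = (1 - 1/2::real) *\<^sub>R a + (1/2::real) *\<^sub>R b"
  have "ereal (q_L m) \<le> f m" by (rule assms)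
  also have "\<dots> \<le> ereal (1 - 1/2) * f a + ereal (1/2) * f b"
    unfolding m_def using assms(1)[unfolded convex_fun_def, rule_format, of "1/2" a b] by simp
  also have "\<dots> \<le> ereal (1 - 1/2) * ereal (q_L a + \<alpha>) + ereal (1/2) * ereal (q_L b + \<beta>)"
    by (intro add_mono ereal_mult_left_mono assms) auto
  finally have "q_L m \<le> 1/2 * (q_L a + \<alpha>) + 1/2 * (q_L b + \<beta>)" by simp
  moreover have "q_L m = 1/2 * q_L a + 1/2 * q_L b - 1/4 * q_L (a - b)"
    by (simp add: m_def q_L_eq blinfun.add_left blinfun.add_right blinfun.diff_left blinfun.diff_right
        blinfun.scaleR_left blinfun.scaleR_right algebra_simps)
  ultimately show ?thesis by (simp add: field_simps)
qed

lemma lower_semicontinuous_limit_le: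
  fixes l :: "'a::real_normed_vector \<times> 'a dual"
  assumes "lower_semicontinuous f" and s: "s \<longlonglongrightarrow> l" and "\<epsilon> \<longlonglongrightarrow> 0"
    and le: "\<And>n. f (s n) \<le> ereal (q_L (s n) + \<epsilon> n)"
  shows "f l \<le> ereal (q_L l)"
proof (rule ccontr)
  assume "\<not> ?thesis"
  then obtain r where r: "ereal (q_L l) < ereal r" "ereal r < f l"
    using ereal_dense2 by (metis not_le)
  have "eventually (\<lambda>y. ereal r < f y) (nhds l)"
    using assms(1) r(2) unfolding lower_semicontinuous_def by blast
  then have *: "eventually (\<lambda>n. ereal r < f (s n)) sequentially"
    using s by (rule eventually_compose_filterlim)
  have "(\<lambda>n. q_L (s n) + \<epsilon> n) \<longlonglongrightarrow> q_L l + 0"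
    by (intro tendsto_add tendsto_q_L assms)
  then have "eventually (\<lambda>n. q_L (s n) + \<epsilon> n < r) sequentially"
    using r(1) by (auto intro: order_tendstoD)
  with * have "eventually (\<lambda>n. False) sequentially"
  proof eventually_elim
    case (elim n)
    have "ereal r < ereal (q_L (s n) + \<epsilon> n)"
      using elim(1) le by (rule less_le_trans)
    with elim(2) show False by simp
  qed
  then show False by simp
qed

section \<open>From approximate to exact coincidence points\<close>

text \<open>
  The accuracies \<open>(\<delta> / 2\<^sup>n)\<^sup>2 / 6\<close> are chosen so that consecutive points of the sequence are at
  distance at most \<open>\<delta> / 2\<^sup>n\<close>.
\<close>

lemma coincidence_point_near:
  fixes f :: "'a::banach \<times> 'a dual \<Rightarrow> ereal"
  assumes convex: "convex_fun f" and "lower_semicontinuous f" and ge: "\<And>b. ereal (q_L b) \<le> f b"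
    and approx: "\<And>c \<epsilon>. \<epsilon> > 0 \<Longrightarrow> \<exists>s. f s \<le> ereal (q_L s + \<epsilon>) \<and> r_L (s - c) \<le> \<epsilon>"
    and "\<delta> > 0" and start: "f s0 \<le> ereal (q_L s0 + \<delta>\<^sup>2 / 6)"
  shows "\<exists>s. f s = ereal (q_L s) \<and> norm (s - s0) \<le> 2 * \<delta>"
proof -
  define \<epsilon> where "\<epsilon> n = (\<delta> * (1/2) ^ n)\<^sup>2 / 6" for n
  have \<epsilon>_pos: "\<epsilon> n > 0" for n using \<open>\<delta> > 0\<close> by (simp add: \<epsilon>_def)
  have \<epsilon>_Suc: "\<epsilon> (Suc n) = \<epsilon> n / 4" for n by (simp add: \<epsilon>_def power2_eq_square)
  have "\<exists>s. \<forall>n. (f (s n) \<le> ereal (q_L (s n) + \<epsilon> n) \<and> (n = 0 \<longrightarrow> s n = s0))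
      \<and> r_L (s (Suc n) - s n) \<le> \<epsilon> (Suc n)"
  proof (rule dependent_nat_choice)
    show "\<exists>x. f x \<le> ereal (q_L x + \<epsilon> 0) \<and> (0 = (0::nat) \<longrightarrow> x = s0)"
      using start by (intro exI[of _ s0]) (simp add: \<epsilon>_def)
  next
    fix x n
    show "\<exists>y. (f y \<le> ereal (q_L y + \<epsilon> (Suc n)) \<and> (Suc n = 0 \<longrightarrow> y = s0))
        \<and> r_L (y - x) \<le> \<epsilon> (Suc n)"
      using approx[OF \<epsilon>_pos[of "Suc n"], of x] by blast
  qed
  then obtain s where s: "\<And>n. f (s n) \<le> ereal (q_L (s n) + \<epsilon> n)" "s 0 = s0"
    "\<And>n. r_L (s (Suc n) - s n) \<le> \<epsilon> (Suc n)" by blast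
  define d where "d n = s (Suc n) - s n" for n
  have norm_d: "norm (d n) \<le> \<delta> * (1/2) ^ n" for n
  proof (rule power2_le_imp_le)
    have "- q_L (d n) \<le> 2 * \<epsilon> (Suc n) + 2 * \<epsilon> n"
      unfolding d_def using convex ge s(1) s(1) by (rule neg_q_L_diff_le)
    moreover have "1/2 * (norm (d n))\<^sup>2 + q_L (d n) \<le> \<epsilon> (Suc n)"
      using s(3)[of n] by (simp add: d_def r_L_def)
    ultimately have "(norm (d n))\<^sup>2 \<le> 6 * \<epsilon> n" using \<epsilon>_pos[of n] \<epsilon>_Suc[of n] by linarith
    then show "(norm (d n))\<^sup>2 \<le> (\<delta> * (1/2) ^ n)\<^sup>2" by (simp add: \<epsilon>_def)
  qed (use \<open>\<delta> > 0\<close> in simp)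
  have geom: "(\<lambda>n. \<delta> * (1/2) ^ n) sums (2 * \<delta>)"
    using sums_mult[OF geometric_sums[of "1/2::real"], of \<delta>] by (simp add: mult.commute)
  have "summable d"
    using sums_summable[OF geom] norm_d by (rule summable_comparison_test')
  then have "(\<lambda>n. s0 + (\<Sum>k<n. d k)) \<longlonglongrightarrow> s0 + suminf d"
    by (intro tendsto_add tendsto_const summable_LIMSEQ)
  then have lim: "s \<longlonglongrightarrow> s0 + suminf d"
    by (simp add: d_def sum_lessThan_telescope s(2))
  have "(\<lambda>n. (\<delta> * (1/2) ^ n)\<^sup>2 / 6) \<longlonglongrightarrow> 0\<^sup>2 / 6"
    using summable_LIMSEQ_zero[OF sums_summable[OF geom]]
    by (intro tendsto_divide tendsto_power tendsto_const) auto
  then have "\<epsilon> \<longlonglongrightarrow> 0" by (simp add: \<epsilon>_def[abs_def])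
  have "f (s0 + suminf d) \<le> ereal (q_L (s0 + suminf d))"
    using assms(2) lim \<open>\<epsilon> \<longlonglongrightarrow> 0\<close> s(1) by (rule lower_semicontinuous_limit_le)
  moreover have "norm (suminf d) \<le> 2 * \<delta>"
    using norm_suminf_le[OF norm_d sums_summable[OF geom]] sums_unique[OF geom] by linarith
  ultimately show ?thesis
    using ge[of "s0 + suminf d"] by (intro exI[of _ "s0 + suminf d"] conjI antisym) (simp_all only: add_diff_cancel_left')
qed

text \<open>
  Convexity bounds \<open>q_L (s - e)\<close> from below, hence also \<open>q_L (s - c)\<close>, up to a term linear in
  \<open>\<parallel>s - c\<parallel>\<close>; then \<open>r_L (s - c) \<le> 1\<close> is a quadratic inequality for \<open>\<parallel>s - c\<parallel>\<close>.
\<close>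

lemma approx_coincidence_bounded:
  assumes "convex_fun f" "\<And>b. ereal (q_L b) \<le> f b" and "f e \<le> ereal (q_L e + M)"
    and "f s \<le> ereal (q_L s + 1)" and r: "r_L (s - c) \<le> 1"
  shows "norm (s - c) \<le> sqrt (12 + 8 * M + 6 * (norm (c - e))\<^sup>2)"
proof (rule real_le_rsqrt)
  let ?v = "s - c" and ?w = "c - e"
  have "- q_L (s - e) \<le> 2 * 1 + 2 * M"
    using assms(1,2,4,3) by (rule neg_q_L_diff_le)
  moreover have "q_L (s - e) = q_L ?v + prod_pairing ?v (L_map ?w) + q_L ?w"
    using q_L_add[of ?v ?w] by simp
  moreover have "norm ?v * norm ?w \<le> 1/4 * (norm ?v)\<^sup>2 + (norm ?w)\<^sup>2"
    using zero_le_power2[of "1/2 * norm ?v - norm ?w"]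
    by (simp add: power2_diff power_mult_distrib power_divide)
  ultimately show "(norm ?v)\<^sup>2 \<le> 12 + 8 * M + 6 * (norm ?w)\<^sup>2"
    using abs_pairing_L_le[of ?v ?w] abs_q_L_le[of ?w] r unfolding r_L_def by linarith
qed

section \<open>The two infimum conditions as approximation properties\<close>

lemma quasidense_iff_r_L:
  "quasidense A \<longleftrightarrow> (\<forall>c. \<forall>\<epsilon>>0. \<exists>s\<in>A. r_L (s - c) \<le> \<epsilon>)"
proof -
  have "(INF (s, s')\<in>A. ereal (1/2 * (norm (s - x))\<^sup>2 + 1/2 * (norm (s' - x'))\<^sup>2
              + blinfun_apply (s' - x') (s - x))) = (INF s\<in>A. ereal (r_L (s - (x, x'))))" for x x'
    by (intro INF_cong)
      (auto simp: r_L_def norm_prod_square q_L_eq algebra_simps)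
  then have "quasidense A \<longleftrightarrow> (\<forall>c. (INF s\<in>A. ereal (r_L (s - c))) \<le> 0)"
    by (simp add: quasidense_def)
  moreover have "(INF s\<in>A. ereal (r_L (s - c))) \<le> 0 \<longleftrightarrow> (\<forall>\<epsilon>>0. \<exists>s\<in>A. r_L (s - c) \<le> \<epsilon>)" for c
  proof
    assume le: "(INF s\<in>A. ereal (r_L (s - c))) \<le> 0"
    show "\<forall>\<epsilon>>0. \<exists>s\<in>A. r_L (s - c) \<le> \<epsilon>"
    proof (intro allI impI)
      fix \<epsilon> :: real assume "\<epsilon> > 0"
      then have "(INF s\<in>A. ereal (r_L (s - c))) < ereal \<epsilon>"
        using le by (simp add: order_le_less_trans)
      then show "\<exists>s\<in>A. r_L (s - c) \<le> \<epsilon>" by (auto simp: INF_less_iff intro: less_imp_le)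
    qed
  next
    assume *: "\<forall>\<epsilon>>0. \<exists>s\<in>A. r_L (s - c) \<le> \<epsilon>"
    show "(INF s\<in>A. ereal (r_L (s - c))) \<le> 0"
    proof (rule ereal_le_epsilon2)
      fix \<epsilon> :: real assume "\<epsilon> > 0"
      with * obtain s where "s \<in> A" "r_L (s - c) \<le> \<epsilon>" by blast
      then show "(INF s\<in>A. ereal (r_L (s - c))) \<le> 0 + ereal \<epsilon>"
        by (auto intro: INF_lower2)
    qed
  qed
  ultimately show ?thesis by simp
qed

lemma shifted_eq:
  "shifted f c b = (f (b + c) - ereal (q_L (b + c))) + ereal (q_L b)"
  unfolding shifted_def q_L_add by (cases "f (b + c)") auto

lemma shifted_add_half_norm_square:
  "shifted f c b + ereal (1/2 * (norm b)\<^sup>2) = (f (b + c) - ereal (q_L (b + c))) + ereal (r_L b)"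
  unfolding shifted_eq r_L_def by (cases "f (b + c)") auto

lemma shifted_infimum_iff_approx:
  assumes ge: "\<And>b. ereal (q_L b) \<le> f b"
  shows "(INF b. shifted f c b + ereal (1/2 * (norm b)\<^sup>2)) \<le> 0
    \<longleftrightarrow> (\<forall>\<epsilon>>0. \<exists>s. f s \<le> ereal (q_L s + \<epsilon>) \<and> r_L (s - c) \<le> \<epsilon>)"
proof
  assume le: "(INF b. shifted f c b + ereal (1/2 * (norm b)\<^sup>2)) \<le> 0"
  show "\<forall>\<epsilon>>0. \<exists>s. f s \<le> ereal (q_L s + \<epsilon>) \<and> r_L (s - c) \<le> \<epsilon>"
  proof (intro allI impI)
    fix \<epsilon> :: real assume "\<epsilon> > 0"
    then have "(INF b. shifted f c b + ereal (1/2 * (norm b)\<^sup>2)) < ereal \<epsilon>"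
      using le by (simp add: order_le_less_trans)
    then obtain b where b: "(f (b + c) - ereal (q_L (b + c))) + ereal (r_L b) < ereal \<epsilon>"
      unfolding INF_less_iff shifted_add_half_norm_square by blast
    then have "f (b + c) \<le> ereal (q_L (b + c) + \<epsilon>)" "r_L b \<le> \<epsilon>"
      using ge[of "b + c"] r_L_nonneg[of b] by (cases "f (b + c)"; simp)+
    then show "\<exists>s. f s \<le> ereal (q_L s + \<epsilon>) \<and> r_L (s - c) \<le> \<epsilon>"
      by (intro exI[of _ "b + c"]) simp
  qed
next
  assume *: "\<forall>\<epsilon>>0. \<exists>s. f s \<le> ereal (q_L s + \<epsilon>) \<and> r_L (s - c) \<le> \<epsilon>"
  show "(INF b. shifted f c b + ereal (1/2 * (norm b)\<^sup>2)) \<le> 0"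
  proof (rule ereal_le_epsilon2)
    fix \<epsilon> :: real assume "\<epsilon> > 0"
    then obtain s where s: "f s \<le> ereal (q_L s + \<epsilon> / 2)" "r_L (s - c) \<le> \<epsilon> / 2"
      using *[rule_format, of "\<epsilon> / 2"] by auto
    have "shifted f c (s - c) + ereal (1/2 * (norm (s - c))\<^sup>2) \<le> ereal \<epsilon>"
      unfolding shifted_add_half_norm_square using s by (cases "f s") auto
    then show "(INF b. shifted f c b + ereal (1/2 * (norm b)\<^sup>2)) \<le> 0 + ereal \<epsilon>"
      by (auto intro: INF_lower2)
  qed
qed

section \<open>The equivalence\<close>

lemma quasidense_coincidence_if_approx:
  fixes f :: "'a::banach \<times> 'a dual \<Rightarrow> ereal"
  assumes "proper_fun f" and convex: "convex_fun f" and lsc: "lower_semicontinuous f"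
    and ge: "\<And>b. ereal (q_L b) \<le> f b"
    and approx: "\<And>c \<epsilon>. \<epsilon> > 0 \<Longrightarrow> \<exists>s. f s \<le> ereal (q_L s + \<epsilon>) \<and> r_L (s - c) \<le> \<epsilon>"
  shows "quasidense {b. f b = ereal (q_L b)}"
  unfolding quasidense_iff_r_L
proof (intro allI impI)
  fix c :: "'a \<times> 'a dual" and \<eta> :: real
  assume "\<eta> > 0"
  obtain e y where "f e = ereal y"
    using \<open>proper_fun f\<close> unfolding proper_fun_def by auto
  moreover define M where "M = y - q_L e"
  ultimately have e: "f e \<le> ereal (q_L e + M)" and "M \<ge> 0"
    using ge[of e] by auto
  define K where "K = sqrt (12 + 8 * M + 6 * (norm (c - e))\<^sup>2)"
  have "K \<ge> 0" using \<open>M \<ge> 0\<close> by (simp add: K_def)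
  \<comment> \<open>The final estimate is \<open>r_L (s - c) \<le> \<delta>\<^sup>2 / 6 + 4 * K * \<delta> + 4 * \<delta>\<^sup>2\<close>, and
    \<open>\<delta> \<le> 1\<close> bounds this by \<open>\<delta> * (5 + 4 * K)\<close>.\<close>
  define \<delta> where "\<delta> = min 1 (\<eta> / (5 + 4 * K))"
  have \<delta>: "\<delta> > 0" "\<delta> \<le> 1" and "\<delta> \<le> \<eta> / (5 + 4 * K)"
    using \<open>\<eta> > 0\<close> \<open>K \<ge> 0\<close> by (auto simp: \<delta>_def)
  then have \<delta>_\<eta>: "\<delta> * (5 + 4 * K) \<le> \<eta>"
    using \<open>K \<ge> 0\<close> by (simp add: pos_le_divide_eq)
  have \<delta>2: "\<delta>\<^sup>2 \<le> \<delta>" using \<delta> by (simp add: power2_eq_square mult_left_le)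
  obtain s0 where s0: "f s0 \<le> ereal (q_L s0 + \<delta>\<^sup>2 / 6)" "r_L (s0 - c) \<le> \<delta>\<^sup>2 / 6"
    using approx[of "\<delta>\<^sup>2 / 6" c] \<delta> by auto
  obtain s where s: "f s = ereal (q_L s)" "norm (s - s0) \<le> 2 * \<delta>"
    using coincidence_point_near[OF convex lsc ge approx \<delta>(1) s0(1)] by blast
  have "f s0 \<le> ereal (q_L s0 + 1)"
    using s0(1) \<delta> \<delta>2 by (auto intro: order_trans)
  then have K: "norm (s0 - c) \<le> K"
    unfolding K_def using s0(2) \<delta> \<delta>2
    by (intro approx_coincidence_bounded[OF convex ge e]) auto
  have "r_L (s - c) \<le> r_L (s0 - c) + 2 * norm (s0 - c) * norm (s - s0) + (norm (s - s0))\<^sup>2"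
    using r_L_add_le[of "s0 - c" "s - s0"] by simp
  also have "\<dots> \<le> \<delta>\<^sup>2 / 6 + 2 * K * (2 * \<delta>) + (2 * \<delta>)\<^sup>2"
    using s0(2) K s(2) \<open>K \<ge> 0\<close> by (intro add_mono mult_mono power_mono) auto
  also have "\<dots> \<le> \<delta> * (5 + 4 * K)"
    using \<delta>2 \<delta>(1) by (simp add: power_mult_distrib algebra_simps)
  finally have "r_L (s - c) \<le> \<eta>" using \<delta>_\<eta> by linarith
  with s(1) show "\<exists>s\<in>{b. f b = ereal (q_L b)}. r_L (s - c) \<le> \<eta>" by blast
qed

theorem theorem4p4:
  fixes f :: "'a::banach \<times> 'a dual \<Rightarrow> ereal"
  assumes "\<exists>x::'a. x \<noteq> 0"
    and "\<And>b. f b \<noteq> - \<infinity>"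
    and "proper_fun f"
    and "convex_fun f"
    and "lower_semicontinuous f"
    and "\<And>b. ereal (q_L b) \<le> f b"
  shows "(\<forall>c b. shifted f c b = (f (b + c) - ereal (q_L (b + c))) + ereal (q_L b)
              \<and> ereal (q_L b) \<le> shifted f c b)
    \<and> (quasidense {b. f b = ereal (q_L b)}
        \<longleftrightarrow> (\<forall>c. (INF b. shifted f c b + ereal (1/2 * (norm b)\<^sup>2)) \<le> 0))"
proof (intro conjI allI)
  fix c b
  show "shifted f c b = (f (b + c) - ereal (q_L (b + c))) + ereal (q_L b)"
    by (rule shifted_eq)
  show "ereal (q_L b) \<le> shifted f c b"
    unfolding shifted_eq using assms(6)[of "b + c"] by (cases "f (b + c)") auto
next
  show "quasidense {b. f b = ereal (q_L b)}
        \<longleftrightarrow> (\<forall>c. (INF b. shifted f c b + ereal (1/2 * (norm b)\<^sup>2)) \<le> 0)"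
    unfolding shifted_infimum_iff_approx[OF assms(6)]
  proof
    assume dense: "quasidense {b. f b = ereal (q_L b)}"
    show "\<forall>c. \<forall>\<epsilon>>0. \<exists>s. f s \<le> ereal (q_L s + \<epsilon>) \<and> r_L (s - c) \<le> \<epsilon>"
    proof (intro allI impI)
      fix c :: "'a \<times> 'a dual" and \<epsilon> :: real
      assume "\<epsilon> > 0"
      with dense obtain s where "f s = ereal (q_L s)" "r_L (s - c) \<le> \<epsilon>"
        unfolding quasidense_iff_r_L by blast
      with \<open>\<epsilon> > 0\<close> show "\<exists>s. f s \<le> ereal (q_L s + \<epsilon>) \<and> r_L (s - c) \<le> \<epsilon>"
        by (intro exI[of _ s]) simp
    qed
  next
    assume "\<forall>c. \<forall>\<epsilon>>0. \<exists>s. f s \<le> ereal (q_L s + \<epsilon>) \<and> r_L (s - c) \<le> \<epsilon>"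
    then show "quasidense {b. f b = ereal (q_L b)}"
      using assms(3-6) by (intro quasidense_coincidence_if_approx) auto
  qed
qed

end
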